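(* Let $n,r$ be positive integers with $\gcd(r,n)=1$, let $K_r=2^{2r}-2^r+1$, and let $e$ be the least positive residue of the inverse of $r$ modulo $n$. Let $a\in\{1,\dots,2^n-2\}$ and let $(a_0,\dots,a_{n-1})\in\{0,1\}^n$ be given by $a_i=\alpha_{(-ir)\bmod n}$, where $a=\sum_{m=0}^{n-1}\alpha_m2^m$ is the binary expansion (so $a\equiv\sum_{i=0}^{n-1}a_i2^{-ir}\pmod{2^n-1}$). The following are equivalent: (a) $a$ is the inverse of $K_r$ modulo $2^n-1$; (b) there exists a sequence $(c_0,\dots,c_{n-1})$ with $c_i\in\{-1,0,1\}$ such that $$2c_0-c_e+1=a_2-a_1+a_0,\qquad 2c_i-c_{i+e}=a_{i+2}-a_{i+1}+a_i\ \text{ for all } i\in\mathbb{Z}_n,\ i\ne0,$$ where indices are taken modulo $n$. Moreover, the sequence $c$ in (b) is unique.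
   Context: Powers $2^{m}$ with arbitrary integer $m$ are understood modulo $2^n-1$, i.e. $2^m=2^{m\bmod n}$. *)

theory Defs
  imports Complex_Main "HOL-Library.FuncSet" "HOL-Number_Theory.Cong"
begin

definition kasami_exponent :: "nat \<Rightarrow> int" where
  "kasami_exponent r = 2 ^ (2 * r) - 2 ^ r + 1"

text \<open>For \<open>n = 1\<close> the value is \<open>1\<close>, not \<open>0\<close>: the residue is required to be positive.\<close>

definition least_pos_inverse :: "nat \<Rightarrow> nat \<Rightarrow> nat" where
  "least_pos_inverse n r = (LEAST e. 0 < e \<and> [r * e = 1] (mod n))"

text \<open>Sequences indexed by the integers modulo \<open>n\<close> are functions on \<open>{..<n}\<close> with indices reduced
  by \<open>mod n\<close>. The carry sequence \<open>c\<close> is taken in the extensional function space, so that equality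
  of functions is equality of the \<open>n\<close>-tuples.\<close>

definition carry_sequence :: "nat \<Rightarrow> nat \<Rightarrow> (nat \<Rightarrow> int) \<Rightarrow> (nat \<Rightarrow> int) \<Rightarrow> bool" where
  "carry_sequence n e s c \<longleftrightarrow>
     c \<in> {..<n} \<rightarrow>\<^sub>E {-1, 0, 1} \<and>
     2 * c 0 - c (e mod n) + 1 = s (2 mod n) - s (1 mod n) + s 0 \<and>
     (\<forall>i<n. i \<noteq> 0 \<longrightarrow>
        2 * c i - c ((i + e) mod n) = s ((i + 2) mod n) - s ((i + 1) mod n) + s i)"

end

theory Submission imports Defs begin

text \<open>At bit position \<open>m\<close> the integer \<open>a * K\<close> has the column sum
  \<open>\<alpha> (m - 2 * r) - \<alpha> (m - r) + \<alpha> m\<close> modulo \<open>2 ^ n - 1\<close>, and (b) says that these column sums, minus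
  the digits of \<open>1\<close>, can be cleared by carries running once around the cycle of bit positions: the
  index \<open>i\<close> stands for the position \<open>- i * r\<close>, so that \<open>i + e\<close> stands for the preceding one. Such carries
  exist iff the weighted sum is divisible by \<open>2 ^ n - 1\<close>. The quotient is the carry into position
  \<open>0\<close>, and it determines all the others. It lies in \<open>{-1, 0, 1}\<close> because the column sums lie between
  \<open>-1\<close> and \<open>2\<close>, and this bound propagates to the next positions.\<close>

lemma least_pos_inverse_cong:
  assumes "0 < n" "coprime r n"
  shows "[r * least_pos_inverse n r = 1] (mod n)"
proof -
  obtain x where x: "[r * x = 1] (mod n)"
    using assms cong_solve_coprime_nat by (metis One_nat_def)
  \<comment> \<open>Adding \<open>n\<close> makes the witness positive: for \<open>n = 1\<close> the
    solution \<open>x\<close> may be \<open>0\<close>.\<close>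
  have "[r * (x + n) = r * x] (mod n)"
    by (simp add: cong_def algebra_simps)
  then have "0 < x + n \<and> [r * (x + n) = 1] (mod n)"
    using x assms(1) cong_trans by auto
  then show ?thesis
    unfolding least_pos_inverse_def by (rule LeastI2) simp
qed

section \<open>Carry recurrences around a cycle of length \<open>n\<close>\<close>

text \<open>Multiplied by \<open>2 ^ m\<close>, the step at \<open>m\<close> telescopes. Keeping the
  power on the left avoids division.\<close>

lemma carry_closed_form:
  fixes D w :: "nat \<Rightarrow> int"
  assumes "\<And>m. m < n \<Longrightarrow> 2 * D (Suc m) = w m + D m" and "m \<le> n"
  shows "2 ^ m * D m = D 0 + (\<Sum>j<m. w j * 2 ^ j)"
  using assms(2)
proof (induction m)
  case (Suc m)
  have "2 ^ Suc m * D (Suc m) = 2 ^ m * (2 * D (Suc m))"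
    by simp
  also have "\<dots> = 2 ^ m * w m + 2 ^ m * D m"
    using Suc.prems by (simp add: assms(1) distrib_left)
  finally show ?case
    using Suc by (simp add: algebra_simps)
qed simp

lemma cyclic_carry_total:
  fixes D w :: "nat \<Rightarrow> int"
  assumes "\<And>m. m < n \<Longrightarrow> 2 * D (Suc m) = w m + D m" and "D n = D 0"
  shows "(\<Sum>j<n. w j * 2 ^ j) = (2 ^ n - 1) * D 0"
  using carry_closed_form[of n D w n] assms by (simp add: algebra_simps)

text \<open>The total fixes \<open>D 0\<close> because \<open>2 ^ n - 1\<close> is nonzero, and the
  closed form then fixes every later value.\<close>

lemma cyclic_carry_unique:
  fixes D D' w :: "nat \<Rightarrow> int"
  assumes "0 < n"
    and D: "\<And>m. m < n \<Longrightarrow> 2 * D (Suc m) = w m + D m" "D n = D 0"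
    and D': "\<And>m. m < n \<Longrightarrow> 2 * D' (Suc m) = w m + D' m" "D' n = D' 0"
    and "m \<le> n"
  shows "D m = D' m"
proof -
  have "(2 ^ n - 1) * D 0 = (2 ^ n - 1) * D' 0"
    using cyclic_carry_total[OF D] cyclic_carry_total[OF D'] by (rule trans[OF sym])
  moreover have "(2::int) ^ n - 1 \<noteq> 0"
    using assms(1) by simp
  ultimately have "D 0 = D' 0"
    using mult_left_cancel by blast
  then have "2 ^ m * D m = 2 ^ m * D' m"
    using carry_closed_form[of n D w m] carry_closed_form[of n D' w m] D D' assms(6) by simp
  then show ?thesis
    by simp
qed

text \<open>The quotient \<open>k\<close> of the sum by \<open>2 ^ n - 1\<close> serves as
  \<open>D 0\<close>. The closed form then forces \<open>D m = S m div 2 ^ m\<close>, so the point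
  is that this division is exact.\<close>

lemma cyclic_carry_exists:
  fixes w :: "nat \<Rightarrow> int"
  assumes "(2 ^ n - 1) dvd (\<Sum>j<n. w j * 2 ^ j)"
  obtains D :: "nat \<Rightarrow> int"
  where "\<And>m. m < n \<Longrightarrow> 2 * D (Suc m) = w m + D m" "D n = D 0"
proof -
  obtain k where k: "(\<Sum>j<n. w j * 2 ^ j) = (2 ^ n - 1) * k"
    using assms by (elim dvdE)
  define S where "S m = k + (\<Sum>j<m. w j * 2 ^ j)" for m
  define D where "D m = S m div 2 ^ m" for m
  have S_n: "S n = 2 ^ n * k"
    by (simp add: S_def k algebra_simps)
  \<comment> \<open>Divisibility comes from the far end: \<open>S n = 2 ^ n * k\<close>, and
    \<open>S n\<close> differs from \<open>S m\<close> only by terms with exponent at least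
    \<open>m\<close>.\<close>
  have dvd: "2 ^ m dvd S m" if "m \<le> n" for m
  proof -
    have "S n = S m + (\<Sum>j\<in>{m..<n}. w j * 2 ^ j)"
      unfolding S_def using that
      by (simp add: lessThan_atLeast0 sum.atLeastLessThan_concat)
    moreover have "2 ^ m dvd (\<Sum>j\<in>{m..<n}. w j * 2 ^ j)"
      by (intro dvd_sum dvd_mult le_imp_power_dvd) simp
    moreover have "2 ^ m dvd S n"
      unfolding S_n using that by (intro dvd_mult2 le_imp_power_dvd)
    ultimately show ?thesis
      by (simp add: dvd_add_left_iff)
  qed
  have D: "2 ^ m * D m = S m" if "m \<le> n" for m
    using dvd[OF that] by (simp add: D_def)
  show thesis
  proof
    fix m assume "m < n"
    then have "2 ^ m * (2 * D (Suc m)) = S (Suc m)"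
      using D[of "Suc m"] by simp
    also have "\<dots> = 2 ^ m * (w m + D m)"
      using D[of m] \<open>m < n\<close> by (simp add: S_def algebra_simps)
    finally show "2 * D (Suc m) = w m + D m"
      by simp
  next
    show "D n = D 0"
      by (simp add: D_def S_n) (simp add: S_def)
  qed
qed

lemma sum_pow2_lessThan: "(\<Sum>j<n. (2::int) ^ j) = 2 ^ n - 1"
  by (induction n) auto

text \<open>The weighted sum of the \<open>t j\<close> lies between \<open>- M\<close> and
  \<open>2 * M\<close>; subtracting \<open>1\<close> leaves \<open>M * D 0\<close> strictly between
  \<open>- 2 * M\<close> and \<open>2 * M\<close>. The lower estimate uses \<open>M > 1\<close>,
  hence \<open>2 \<le> n\<close>.\<close>

lemma cyclic_carry_bounded:
  fixes D t :: "nat \<Rightarrow> int"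
  assumes "2 \<le> n"
    and t: "\<And>m. m < n \<Longrightarrow> t m \<in> {-1..2}"
    and D: "\<And>m. m < n \<Longrightarrow> 2 * D (Suc m) = (t m - of_bool (m = 0)) + D m" "D n = D 0"
    and "m \<le> n"
  shows "D m \<in> {-1..1}"
proof -
  define M :: int where "M = 2 ^ n - 1"
  have "(2::int) ^ 2 \<le> 2 ^ n"
    using assms(1) by (intro power_increasing) auto
  then have M: "3 \<le> M"
    by (simp add: M_def)
  have "(\<Sum>j<n. (t j - of_bool (j = 0)) * 2 ^ j)
      = (\<Sum>j<n. t j * 2 ^ j) - (\<Sum>j<n. if j = 0 then 1 else 0)"
    unfolding sum_subtractf[symmetric] by (intro sum.cong) (auto simp: algebra_simps)
  also have "(\<Sum>j<n. if j = 0 then 1 else 0 :: int) = 1"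
    using assms(1) by (simp add: sum.delta)
  finally have total: "M * D 0 = (\<Sum>j<n. t j * 2 ^ j) - 1"
    using cyclic_carry_total[OF D] by (simp add: M_def)
  have "(\<Sum>j<n. t j * 2 ^ j) \<le> (\<Sum>j<n. 2 * 2 ^ j)"
    using t by (intro sum_mono mult_right_mono) auto
  then have "M * D 0 < M * 2"
    using total by (simp add: M_def sum_pow2_lessThan flip: sum_distrib_left)
  then have upper: "D 0 \<le> 1"
    using M by simp
  have "(\<Sum>j<n. (-1) * 2 ^ j) \<le> (\<Sum>j<n. t j * 2 ^ j)"
    using t by (intro sum_mono mult_right_mono) auto
  then have "- M \<le> (\<Sum>j<n. t j * 2 ^ j)"
    by (simp add: M_def sum_pow2_lessThan sum_negf)
  then have "M * (-2) < M * D 0"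
    using total M by simp
  then have lower: "-1 \<le> D 0"
    using M by (simp only: mult_less_cancel_left) auto
  show ?thesis
    using \<open>m \<le> n\<close>
  proof (induction m)
    case 0
    show ?case using upper lower by simp
  next
    \<comment> \<open>Here \<open>2 * D (Suc m)\<close> lies between \<open>-3\<close> and
      \<open>3\<close>, so integrality gives the bound.\<close>
    case (Suc m)
    then show ?case
      using D(1)[of m] t[of m] by (auto simp: of_bool_def split: if_splits)
  qed
qed

section \<open>Digit rotations modulo \<open>2 ^ n - 1\<close>\<close>

lemma pow2_mod_cong: "[2 ^ (k mod n) = 2 ^ k] (mod (2 ^ n - 1 :: int))"
proof -
  have "[2 ^ n = 1] (mod (2 ^ n - 1 :: int))"
    by (simp add: cong_iff_dvd_diff)
  then have "[(2 ^ n) ^ (k div n) * 2 ^ (k mod n) = 1 ^ (k div n) * 2 ^ (k mod n)] (mod (2 ^ n - 1 :: int))"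
    by (intro cong_mult cong_pow cong_refl)
  then show ?thesis
    by (simp add: cong_sym flip: power_mult power_add)
qed

text \<open>Rotation by \<open>k\<close> places moves the digit at \<open>m\<close> to
  \<open>(m + k) mod n\<close>, and exponents may be reduced modulo \<open>n\<close> because
  \<open>2 ^ n\<close> is congruent to \<open>1\<close>.\<close>

lemma cyclic_shift_cong:
  fixes \<alpha> :: "nat \<Rightarrow> int"
  assumes "0 < n"
  shows "[(\<Sum>m<n. \<alpha> (nat ((int m - int k) mod int n)) * 2 ^ m) = 2 ^ k * (\<Sum>m<n. \<alpha> m * 2 ^ m)]
           (mod (2 ^ n - 1))"
proof -
  define f where "f m = (m + k) mod n" for m
  define g where "g m = nat ((int m - int k) mod int n)" for m
  have g_lt: "g m < n" for m
    using assms by (simp add: g_def nat_less_iff)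
  have gf: "g (f m) = m" if "m < n" for m
    using that by (simp add: g_def f_def zmod_int mod_simps)
  have fg: "f (g m) = m" if "m < n" for m
  proof -
    have "int (f (g m)) = int m"
      using that assms by (simp add: g_def f_def zmod_int mod_simps)
    then show ?thesis by simp
  qed
  have "(\<Sum>m<n. \<alpha> (g m) * 2 ^ m) = (\<Sum>m<n. \<alpha> m * 2 ^ f m)"
    by (rule sum.reindex_bij_witness[where i = f and j = g])
      (use assms g_lt gf fg in \<open>auto simp: f_def\<close>)
  also have "[\<dots> = (\<Sum>m<n. \<alpha> m * 2 ^ (m + k))] (mod (2 ^ n - 1))"
    unfolding f_def by (intro cong_sum cong_mult cong_refl pow2_mod_cong)
  also have "(\<Sum>m<n. \<alpha> m * 2 ^ (m + k)) = 2 ^ k * (\<Sum>m<n. \<alpha> m * 2 ^ m)"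
    by (simp add: sum_distrib_left power_add mult_ac)
  finally show ?thesis
    by (simp add: g_def)
qed

section \<open>Correspondence between indices and bit positions\<close>

locale kasami_setting =
  fixes n r e :: nat and \<alpha> s :: "nat \<Rightarrow> int"
  assumes n_ge_2: "2 \<le> n"
    and inverse: "[r * e = 1] (mod n)"
    and bits: "\<And>m. m < n \<Longrightarrow> \<alpha> m \<in> {0, 1}"
    and s_eq: "\<And>i. i < n \<Longrightarrow> s i = \<alpha> (nat ((- (int i * int r)) mod int n))"
begin

text \<open>The digits are extended periodically to all integer positions, so that a rotation
  becomes plain subtraction.\<close>

definition shifted :: "int \<Rightarrow> int" where
  "shifted z = \<alpha> (nat (z mod int n))"

definition column :: "nat \<Rightarrow> int" where
  "column m = shifted (int m - int (2 * r)) - shifted (int m - int r) + shifted (int m)"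

definition position :: "nat \<Rightarrow> nat" where
  "position i = nat ((- (int i * int r)) mod int n)"

text \<open>Multiplication by \<open>- e\<close> undoes multiplication by \<open>- r\<close> modulo
  \<open>n\<close>, so this inverts \<open>position\<close> on \<open>{..<n}\<close>.\<close>

definition index :: "nat \<Rightarrow> nat" where
  "index m = nat ((- (int e * int m)) mod int n)"

lemma position_less: "position i < n"
  using n_ge_2 by (simp add: position_def nat_less_iff)

lemma index_less: "index m < n"
  using n_ge_2 by (simp add: index_def nat_less_iff)

lemma inverse_int: "[int r * int e = 1] (mod int n)"
  using inverse by (metis cong_int_iff of_nat_1 of_nat_mult)

lemma position_cong: "[int (position i) = - (int i * int r)] (mod int n)"
  using n_ge_2 by (simp add: position_def cong_def)

lemma index_cong: "[int (index m) = - (int e * int m)] (mod int n)"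
  using n_ge_2 by (simp add: index_def cong_def)

lemma eq_if_cong: "i = j" if "[int i = int j] (mod int n)" "i < n" "j < n" for i j
  using that by (simp add: cong_int_iff cong_less_modulus_unique_nat)

lemma position_index:
  assumes "m < n"
  shows "position (index m) = m"
proof (rule eq_if_cong)
  have "[int (position (index m)) = - (- (int e * int m) * int r)] (mod int n)"
    by (rule cong_trans[OF position_cong]) (intro cong_minus_minus_iff[THEN iffD2] cong_mult index_cong cong_refl)
  also have "- (- (int e * int m) * int r) = int r * int e * int m"
    by simp
  also have "[\<dots> = 1 * int m] (mod int n)"
    by (intro cong_mult inverse_int cong_refl)
  finally show "[int (position (index m)) = int m] (mod int n)"
    by simp
qed (use assms position_less in auto)

lemma index_position:
  assumes "i < n"
  shows "index (position i) = i"
proof (rule eq_if_cong)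
  have "[int (index (position i)) = - (int e * - (int i * int r))] (mod int n)"
    by (rule cong_trans[OF index_cong]) (intro cong_minus_minus_iff[THEN iffD2] cong_mult position_cong cong_refl)
  also have "- (int e * - (int i * int r)) = int r * int e * int i"
    by simp
  also have "[\<dots> = 1 * int i] (mod int n)"
    by (intro cong_mult inverse_int cong_refl)
  finally show "[int (index (position i)) = int i] (mod int n)"
    by simp
qed (use assms index_less in auto)

lemma position_0: "position 0 = 0"
  by (simp add: position_def)

lemma index_0: "index 0 = 0"
  by (simp add: index_def)

lemma position_eq_0_iff: "i < n \<Longrightarrow> position i = 0 \<longleftrightarrow> i = 0"
  using index_position[of i] index_0 position_0 by auto

text \<open>One step up in position changes the index by \<open>- e\<close>. The case
  \<open>Suc m = n\<close> is included, which closes the cycle.\<close>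

lemma index_pred:
  assumes "0 < n"
  shows "index m = (index (Suc m) + e) mod n"
proof (rule eq_if_cong)
  have "[int (index (Suc m)) + int e = - (int e * int (Suc m)) + int e] (mod int n)"
    by (intro cong_add index_cong cong_refl)
  also have "- (int e * int (Suc m)) + int e = - (int e * int m)"
    by (simp add: algebra_simps)
  also have "[\<dots> = int (index m)] (mod int n)"
    by (rule cong_sym[OF index_cong])
  finally show "[int (index m) = int ((index (Suc m) + e) mod n)] (mod int n)"
    by (simp add: cong_def zmod_int)
qed (use assms index_less in auto)

section \<open>Column sums of the product\<close>

text \<open>As the position of \<open>i\<close> is \<open>- i * r\<close> modulo \<open>n\<close>,
  raising the index by \<open>k\<close> lowers the position by \<open>k * r\<close>.\<close>

lemma s_shift:
  assumes "i < n"
  shows "s ((i + k) mod n) = shifted (int (position i) - int (k * r))"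
proof -
  have "[- (int ((i + k) mod n) * int r) = - (int (i + k) * int r)] (mod int n)"
    by (intro cong_minus_minus_iff[THEN iffD2] cong_mult cong_refl) (simp add: cong_def zmod_int)
  also have "- (int (i + k) * int r) = - (int i * int r) - int (k * r)"
    by (simp add: algebra_simps)
  also have "[\<dots> = int (position i) - int (k * r)] (mod int n)"
    by (intro cong_diff cong_refl cong_sym[OF position_cong])
  finally have "- (int ((i + k) mod n) * int r) mod int n = (int (position i) - int (k * r)) mod int n"
    by (simp only: cong_def)
  moreover have "(i + k) mod n < n"
    using n_ge_2 by simp
  ultimately show ?thesis
    by (simp only: s_eq shifted_def)
qed

lemma s_column:
  assumes "i < n"
  shows "s ((i + 2) mod n) - s ((i + 1) mod n) + s i = column (position i)"
proof -
  have "s i = shifted (int (position i))"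
    using s_shift[OF assms, of 0] assms by simp
  then show ?thesis
    using s_shift[OF assms, of 1] s_shift[OF assms, of 2] by (simp only: column_def mult_1)
qed

lemma column_bounds: "column m \<in> {-1..2}"
proof -
  have "shifted z \<in> {0, 1}" for z
    unfolding shifted_def using n_ge_2 by (intro bits) (simp add: nat_less_iff)
  from this[of "int m - int (2 * r)"] this[of "int m - int r"] this[of "int m"]
  show ?thesis
    unfolding column_def by auto
qed

text \<open>Each power of two in \<open>kasami_exponent r\<close> acts on the digits as a rotation,
  by \<open>2 * r\<close>, \<open>r\<close> or \<open>0\<close> places; the columns add the rotated
  digits with the same signs.\<close>

lemma column_sum_cong:
  "[(\<Sum>m<n. column m * 2 ^ m) = (\<Sum>m<n. \<alpha> m * 2 ^ m) * kasami_exponent r] (mod (2 ^ n - 1))"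
proof -
  let ?a = "\<Sum>m<n. \<alpha> m * 2 ^ m"
  let ?T = "\<lambda>k. \<Sum>m<n. shifted (int m - int k) * 2 ^ m"
  have "0 < n"
    using n_ge_2 by simp
  then have shift: "[?T k = 2 ^ k * ?a] (mod (2 ^ n - 1))" for k
    unfolding shifted_def by (rule cyclic_shift_cong)
  have "column m * 2 ^ m = shifted (int m - int (2 * r)) * 2 ^ m - shifted (int m - int r) * 2 ^ m
      + shifted (int m - int 0) * 2 ^ m" for m
    by (simp only: column_def ring_distribs of_nat_0 diff_0_right)
  then have "(\<Sum>m<n. column m * 2 ^ m) = ?T (2 * r) - ?T r + ?T 0"
    by (simp only: sum.distrib sum_subtractf)
  moreover have "?a * kasami_exponent r = 2 ^ (2 * r) * ?a - 2 ^ r * ?a + 2 ^ 0 * ?a"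
    unfolding kasami_exponent_def
    by (simp only: distrib_left right_diff_distrib power_0 mult_1_left mult_1_right mult.commute[of ?a])
  moreover have "[?T (2 * r) - ?T r + ?T 0 = 2 ^ (2 * r) * ?a - 2 ^ r * ?a + 2 ^ 0 * ?a] (mod (2 ^ n - 1))"
    by (rule cong_add[OF cong_diff[OF shift shift] shift])
  ultimately show ?thesis
    by (simp only:)
qed

section \<open>Carry sequences as cyclic carries\<close>

text \<open>The cycle is cut open at position \<open>0\<close>, so that \<open>D n\<close> and
  \<open>D 0\<close> denote the same carry. The range of the carries is left to
  \<open>cyclic_carry_bounded\<close>.\<close>

definition cyclic_carries :: "(nat \<Rightarrow> int) \<Rightarrow> bool" where
  "cyclic_carries D \<longleftrightarrow>
     (\<forall>m<n. 2 * D (Suc m) = (column m - of_bool (m = 0)) + D m) \<and> D n = D 0"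

text \<open>The term \<open>of_bool (i = 0)\<close>, the digit of \<open>1\<close> at
  \<open>position i\<close>, merges the exceptional equation with the others.\<close>

lemma carry_sequence_iff:
  "carry_sequence n e s c \<longleftrightarrow>
     c \<in> {..<n} \<rightarrow>\<^sub>E {-1, 0, 1} \<and>
     (\<forall>i<n. 2 * c i - c ((i + e) mod n) + of_bool (i = 0) = column (position i))"
proof -
  let ?Q = "\<lambda>i. 2 * c i - c ((i + e) mod n) + of_bool (i = 0) = column (position i)"
  have "(\<forall>i<n. i \<noteq> 0 \<longrightarrow> 2 * c i - c ((i + e) mod n) = s ((i + 2) mod n) - s ((i + 1) mod n) + s i) \<longleftrightarrow>
      (\<forall>i<n. i \<noteq> 0 \<longrightarrow> 2 * c i - c ((i + e) mod n) = column (position i))"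
    using s_column by metis
  moreover have "s (2 mod n) - s (1 mod n) + s 0 = column (position 0)"
    using s_column[of 0] n_ge_2 by (simp only: add_0_left)
  ultimately have "carry_sequence n e s c \<longleftrightarrow> c \<in> {..<n} \<rightarrow>\<^sub>E {-1, 0, 1} \<and>
      2 * c 0 - c (e mod n) + 1 = column (position 0) \<and>
      (\<forall>i<n. i \<noteq> 0 \<longrightarrow> 2 * c i - c ((i + e) mod n) = column (position i))"
    by (simp only: carry_sequence_def)
  moreover have "0 < n"
    using n_ge_2 by simp
  then have "(\<forall>i<n. P i) \<longleftrightarrow> P 0 \<and> (\<forall>i<n. i \<noteq> 0 \<longrightarrow> P i)" for P
    by metis
  note this[of ?Q]
  ultimately show ?thesis
    by simp
qed

text \<open>\<open>D m\<close> is the carry entering position \<open>m\<close>, which is the one leaving position \<open>m - 1\<close>;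
  the index of the latter is \<open>index m + e\<close>.\<close>

lemma cyclic_carries_of_carry_sequence:
  assumes "carry_sequence n e s c"
  defines "D \<equiv> \<lambda>m. c ((index m + e) mod n)"
  shows "cyclic_carries D" and "\<And>i. i < n \<Longrightarrow> c i = D (Suc (position i))"
proof -
  have D_Suc: "D (Suc m) = c (index m)" for m
    using index_pred[of m] n_ge_2 by (simp add: D_def)
  show "c i = D (Suc (position i))" if "i < n" for i
    using that by (simp add: D_Suc index_position)
  have "2 * D (Suc m) = (column m - of_bool (m = 0)) + D m" if "m < n" for m
  proof -
    have "index m = 0 \<longleftrightarrow> m = 0"
      using position_index[OF that] index_0 position_0 by auto
    moreover have "2 * c (index m) - c ((index m + e) mod n) + of_bool (index m = 0)
        = column (position (index m))"
      using assms(1) index_less carry_sequence_iff by simp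
    ultimately show ?thesis
      using position_index[OF that] unfolding D_Suc by (simp add: D_def)
  qed
  moreover have "D n = D 0"
    by (simp add: D_def index_def)
  ultimately show "cyclic_carries D"
    by (simp add: cyclic_carries_def)
qed

text \<open>The value at \<open>i\<close> is the carry leaving \<open>position i\<close>, hence the
  \<open>Suc\<close>. The equations hold because index \<open>i + e\<close> belongs to the preceding
  position.\<close>

lemma carry_sequence_of_cyclic_carries:
  assumes "cyclic_carries D"
  shows "carry_sequence n e s (\<lambda>i\<in>{..<n}. D (Suc (position i)))" (is "carry_sequence n e s ?c")
proof -
  have step: "2 * D (Suc m) = (column m - of_bool (m = 0)) + D m" if "m < n" for m
    using assms that by (simp add: cyclic_carries_def)
  have wrap: "D n = D 0"
    using assms by (simp add: cyclic_carries_def)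
  have "D (Suc (position i)) \<in> {-1..1}" for i
    using cyclic_carry_bounded[OF n_ge_2 column_bounds step wrap] position_less[of i] by simp
  moreover have "{-1..1} = {-1, 0, 1 :: int}"
    by auto
  ultimately have range: "?c \<in> {..<n} \<rightarrow>\<^sub>E {-1, 0, 1}"
    by auto
  have "2 * ?c i - ?c ((i + e) mod n) + of_bool (i = 0) = column (position i)" if "i < n" for i
  proof -
    have "D (Suc (position ((i + e) mod n))) = D (position i)"
    proof (cases "position i")
      case 0
      then have "i = 0"
        using position_eq_0_iff that by simp
      \<comment> \<open>Position \<open>0\<close> is read as \<open>Suc (n - 1) = n\<close>, whose
        index is again \<open>0\<close>; \<open>wrap\<close> then identifies the two
        carries.\<close>
      have "index (n - 1) = (index (Suc (n - 1)) + e) mod n"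
        using n_ge_2 by (intro index_pred) simp
      then have "index (n - 1) = (i + e) mod n"
        using \<open>i = 0\<close> n_ge_2 by (simp add: index_def)
      then have "position ((i + e) mod n) = n - 1"
        using position_index[of "n - 1"] n_ge_2 by simp
      then show ?thesis
        using wrap 0 n_ge_2 by simp
    next
      case (Suc m)
      have "index m = (i + e) mod n"
        using index_pred[of m] n_ge_2 index_position[OF that] by (simp add: Suc)
      then have "position ((i + e) mod n) = m"
        using position_index[of m] position_less[of i] Suc by simp
      then show ?thesis
        by (simp add: Suc)
    qed
    then show ?thesis
      using step[OF position_less] position_eq_0_iff[OF that] that n_ge_2 by simp
  qed
  then show ?thesis
    unfolding carry_sequence_iff using range by blast
qed

section \<open>Equivalence and uniqueness\<close>

theorem kasami_inverse_iff:
  "[(\<Sum>m<n. \<alpha> m * 2 ^ m) * kasami_exponent r = 1] (mod (2 ^ n - 1)) \<longleftrightarrow>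
     (\<exists>c. carry_sequence n e s c)"
proof -
  let ?w = "\<lambda>m. column m - of_bool (m = 0)"
  have "(\<Sum>m<n. ?w m * 2 ^ m) = (\<Sum>m<n. column m * 2 ^ m) - (\<Sum>m<n. if m = 0 then 1 else 0)"
    unfolding sum_subtractf[symmetric] by (intro sum.cong) (auto simp: algebra_simps)
  also have "(\<Sum>m<n. if m = 0 then 1 else 0 :: int) = 1"
    using n_ge_2 by (simp add: sum.delta)
  finally have w: "(\<Sum>m<n. ?w m * 2 ^ m) = (\<Sum>m<n. column m * 2 ^ m) - 1" .
  have "[(\<Sum>m<n. \<alpha> m * 2 ^ m) * kasami_exponent r = 1] (mod (2 ^ n - 1)) \<longleftrightarrow>
      [(\<Sum>m<n. column m * 2 ^ m) = 1] (mod (2 ^ n - 1))"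
    using column_sum_cong cong_sym cong_trans by blast
  also have "\<dots> \<longleftrightarrow> (2 ^ n - 1) dvd (\<Sum>m<n. ?w m * 2 ^ m)"
    by (simp add: w cong_iff_dvd_diff)
  also have "\<dots> \<longleftrightarrow> (\<exists>D. cyclic_carries D)"
  proof
    assume "(2 ^ n - 1) dvd (\<Sum>m<n. ?w m * 2 ^ m)"
    then obtain D where "\<And>m. m < n \<Longrightarrow> 2 * D (Suc m) = ?w m + D m" "D n = D 0"
      by (rule cyclic_carry_exists) blast
    then show "\<exists>D. cyclic_carries D"
      unfolding cyclic_carries_def by blast
  next
    assume "\<exists>D. cyclic_carries D"
    then obtain D where "\<And>m. m < n \<Longrightarrow> 2 * D (Suc m) = ?w m + D m" "D n = D 0"
      unfolding cyclic_carries_def by blast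
    then have "(\<Sum>m<n. ?w m * 2 ^ m) = (2 ^ n - 1) * D 0"
      by (rule cyclic_carry_total)
    then show "(2 ^ n - 1) dvd (\<Sum>m<n. ?w m * 2 ^ m)"
      by (rule dvdI)
  qed
  also have "\<dots> \<longleftrightarrow> (\<exists>c. carry_sequence n e s c)"
    using carry_sequence_of_cyclic_carries cyclic_carries_of_carry_sequence(1) by blast
  finally show ?thesis .
qed

text \<open>Both sequences are read off from solutions of the same cyclic recurrence, and
  \<open>cyclic_carry_unique\<close> makes these agree.\<close>

theorem carry_sequence_unique:
  assumes c: "carry_sequence n e s c" and c': "carry_sequence n e s c'"
  shows "c = c'"
proof (rule extensionalityI)
  show "c \<in> extensional {..<n}" "c' \<in> extensional {..<n}"
    using assms by (auto simp: carry_sequence_def PiE_def)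
next
  fix i assume "i \<in> {..<n}"
  then have i: "i < n" by simp
  obtain D where D: "cyclic_carries D" "c i = D (Suc (position i))"
    using cyclic_carries_of_carry_sequence[OF c] i by blast
  obtain D' where D': "cyclic_carries D'" "c' i = D' (Suc (position i))"
    using cyclic_carries_of_carry_sequence[OF c'] i by blast
  have "D (Suc (position i)) = D' (Suc (position i))"
    using D(1) D'(1) n_ge_2 position_less[of i] unfolding cyclic_carries_def
    by - (rule cyclic_carry_unique[where w = "\<lambda>m. column m - of_bool (m = 0)" and n = n], auto)
  then show "c i = c' i"
    using D D' by simp
qed

end

theorem theorem6:
  fixes n r e :: nat and a :: int and \<alpha> s :: "nat \<Rightarrow> int"
  assumes "0 < n" and "0 < r" and "gcd r n = 1"
    and "e = least_pos_inverse n r"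
    and "a \<in> {1..2 ^ n - 2}"
    and "\<forall>m<n. \<alpha> m \<in> {0, 1}"
    and "a = (\<Sum>m<n. \<alpha> m * 2 ^ m)"
    and "\<forall>i<n. s i = \<alpha> (nat ((- (int i * int r)) mod int n))"
  shows "([a * kasami_exponent r = 1] (mod (2 ^ n - 1)) \<longleftrightarrow> (\<exists>c. carry_sequence n e s c)) \<and>
         (\<exists>\<^sub>\<le>\<^sub>1 c. carry_sequence n e s c)"
proof -
  \<comment> \<open>For \<open>n = 1\<close> the interval \<open>{1..2 ^ n - 2}\<close> is
    empty.\<close>
  have "n \<noteq> 1"
    using assms(5) by auto
  then have "2 \<le> n"
    using assms(1) by simp
  moreover have "[r * e = 1] (mod n)"
    using assms(1,3,4) least_pos_inverse_cong by (simp add: coprime_iff_gcd_eq_1)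
  ultimately interpret kasami_setting n r e \<alpha> s
    using assms(6,8) by unfold_locales auto
  show ?thesis
    unfolding assms(7) using kasami_inverse_iff carry_sequence_unique
    by (auto intro: Uniq_I)
qed

end
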